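(* Let $q$ be a prime power, let $n\ge 1$, and let $\mathcal{M}$ be an $\mathbb{F}_q$-subspace of $M_n(\mathbb{F}_q)$ of dimension $d>0$, all of whose elements have zero determinant. Suppose that the determinantal polynomial $P_{\mathcal{M}}$ is not the zero polynomial. Then $q<n$.
   Context: $M_n(K)$ is the $K$-vector space of $n\times n$ matrices over a field $K$. For a $d$-dimensional subspace $\mathcal{M}$ of $M_n(K)$, $d\ge 1$, with basis $M_1,\dots,M_d$, the determinantal polynomial of $\mathcal{M}$ (with respect to this basis) is $P_{\mathcal{M}}(x_1,\dots,x_d)=\det(x_1M_1+\cdots+x_dM_d)\in K[x_1,\dots,x_d]$, where the $x_i$ are independent indeterminates. A change of basis changes $P_{\mathcal{M}}$ by an invertible linear change of variables, so whether it is the zero polynomial does not depend on the basis. *)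

theory Defs
  imports "HOL-Analysis.Analysis" "HOL-Library.Poly_Mapping"
begin

(* The library's \<open>*s\<close> on iterated vectors scales by a row, and \<open>*\<^sub>R\<close> is restricted to the
   reals, so the vector space of matrices over an arbitrary field is set up here. *)

definition mat_scale :: "'a::times \<Rightarrow> 'a^'n^'m \<Rightarrow> 'a^'n^'m" where
  "mat_scale c A = (\<chi> i j. c * A $ i $ j)"

interpretation matspace: vector_space "mat_scale :: 'a::field \<Rightarrow> 'a^'n^'m \<Rightarrow> 'a^'n^'m"
  by unfold_locales (simp_all add: mat_scale_def vec_eq_iff algebra_simps)

(* Polynomials in the indeterminates x_0, x_1, ..., as finitely supported maps from monomials
   (finitely supported exponent functions) to coefficients, with the convolution product. *)

type_synonym 'a mpoly = "(nat \<Rightarrow>\<^sub>0 nat) \<Rightarrow>\<^sub>0 'a"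

definition mpoly_const :: "'a::zero \<Rightarrow> 'a mpoly" where
  "mpoly_const c = Poly_Mapping.single 0 c"

definition mpoly_var :: "nat \<Rightarrow> 'a::zero_neq_one mpoly" where
  "mpoly_var k = Poly_Mapping.single (Poly_Mapping.single k 1) 1"

definition ordered_matrix_basis :: "nat \<Rightarrow> (nat \<Rightarrow> 'a::field^'n^'m) \<Rightarrow> ('a^'n^'m) set \<Rightarrow> bool" where
  "ordered_matrix_basis d B M \<longleftrightarrow>
     inj_on B {..<d} \<and> matspace.independent (B ` {..<d}) \<and> matspace.span (B ` {..<d}) = M"

(* The determinant is taken over the polynomial ring, so this is a formal polynomial and not
   the function it induces; over a finite field the difference matters. *)

definition determinantal_poly :: "nat \<Rightarrow> (nat \<Rightarrow> 'a::comm_ring_1^'n^'n) \<Rightarrow> 'a mpoly" where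
  "determinantal_poly d B = det (\<chi> i j. \<Sum>k<d. mpoly_var k * mpoly_const (B k $ i $ j))"

end

theory Submission
  imports Defs
begin

text \<open>Expanding the determinant along the choices of one basis matrix per row writes \<open>P\<close> as a sum
  of monomials of degree \<open>n\<close>. Suppose \<open>n \<le> q\<close>. No variable occurs in \<open>P\<close> with exponent \<open>q\<close>: this
  would force \<open>n = q\<close> and the monomial \<open>x_k^n\<close>, whose coefficient is \<open>det (B k) = 0\<close>. So \<open>P\<close> has
  degree less than \<open>q\<close> in every variable, and as it vanishes on all of \<open>K^d\<close> it is zero.\<close>

text \<open>\<open>S\<close> is an abstract index set of monomials, with \<open>e m k\<close> the exponent of \<open>x_k\<close> in \<open>m\<close>, so that
  the induction on \<open>d\<close> can pass to the indices with a given last exponent.\<close>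

lemma reduced_polynomial_function_eq_0:
  fixes c :: "'b \<Rightarrow> 'k::{field,finite}" and e :: "'b \<Rightarrow> nat \<Rightarrow> nat"
  assumes "finite S"
    and "\<And>m m'. m \<in> S \<Longrightarrow> m' \<in> S \<Longrightarrow> (\<And>k. k < d \<Longrightarrow> e m k = e m' k) \<Longrightarrow> m = m'"
    and "\<And>m k. m \<in> S \<Longrightarrow> k < d \<Longrightarrow> e m k < CARD('k)"
    and "\<And>a. (\<Sum>m\<in>S. c m * (\<Prod>k<d. a k ^ e m k)) = 0"
    and "m \<in> S"
  shows "c m = 0"
  using assms
proof (induction d arbitrary: S m)
  case 0
  \<comment> \<open>With no variables the injectivity hypothesis is vacuous, so \<open>S\<close> has
    a single element, and the vanishing sum is its coefficient times the empty product.\<close>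
  then have "S = {m}" by auto
  then show ?case using "0.prems"(4) by simp
next
  case (Suc d)
  let ?T = "{m' \<in> S. e m' d = e m d}"
  have "(\<Sum>m'\<in>?T. c m' * (\<Prod>k<d. a k ^ e m' k)) = 0" for a :: "nat \<Rightarrow> 'k"
  proof -
    \<comment> \<open>The first \<open>d\<close> variables are fixed at \<open>a\<close>, and the
      last one stays an indeterminate. The coefficient of \<open>p\<close> at \<open>e m d\<close>
      is the sum over \<open>?T\<close> to be shown zero.\<close>
    define p where "p = (\<Sum>m\<in>S. monom (c m * (\<Prod>k<d. a k ^ e m k)) (e m d))"
    have "degree p < CARD('k)"
      unfolding p_def
    proof (rule degree_sum_less)
      show "degree (monom (c m * (\<Prod>k<d. a k ^ e m k)) (e m d)) < CARD('k)" if "m \<in> S" for m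
        using Suc.prems(3)[OF that, of d] by (meson degree_monom_le le_less_trans lessI)
    qed simp
    moreover have "poly p x = 0" for x
    proof -
      have "poly p x = (\<Sum>m\<in>S. c m * (\<Prod>k<Suc d. (a(d := x)) k ^ e m k))"
        by (simp add: p_def poly_sum poly_monom mult.assoc)
      then show ?thesis using Suc.prems(4)[of "a(d := x)"] by simp
    qed
    ultimately have "p = 0"
      \<comment> \<open>Every field element is a root, which is more roots than the degree allows
        for a nonzero \<open>p\<close>.\<close>
      using card_poly_roots_bound[of p] by fastforce
    then have "coeff p (e m d) = 0" by simp
    then show ?thesis
      using Suc.prems(1) by (simp add: p_def coeff_sum sum.inter_filter)
  qed
  then show ?case
  proof (rule Suc.IH[rotated 3])
    \<comment> \<open>All indices in \<open>?T\<close> share the exponent of the last variable, so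
      the first \<open>d\<close> exponents already separate them.\<close>
    show "m' = m''" if "m' \<in> ?T" "m'' \<in> ?T" "\<And>k. k < d \<Longrightarrow> e m' k = e m'' k" for m' m''
      using that by (intro Suc.prems(2)) (auto simp: less_Suc_eq)
  qed (use Suc.prems(1,3,5) in auto)
qed

text \<open>Row \<open>i\<close> is taken from the basis matrix with index \<open>f i\<close>,
  contributing one factor \<open>x_(f i)\<close>; exponents add under multiplication, hence the
  sum.\<close>

definition choice_monomial :: "('n::finite \<Rightarrow> nat) \<Rightarrow> nat \<Rightarrow>\<^sub>0 nat" where
  "choice_monomial f = (\<Sum>i\<in>UNIV. Poly_Mapping.single (f i) 1)"

lemma lookup_choice_monomial: "Poly_Mapping.lookup (choice_monomial f) k = card {i. f i = k}"
proof -
  have "Poly_Mapping.lookup (choice_monomial f) k = (\<Sum>i\<in>UNIV. if f i = k then 1 else 0)"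
    unfolding choice_monomial_def lookup_sum
    by (intro sum.cong) (auto simp: lookup_single when_def)
  then show ?thesis by (simp add: sum.If_cases)
qed

lemma prod_eq_choice_monomial:
  fixes f :: "'n::finite \<Rightarrow> nat" and a :: "nat \<Rightarrow> 'a::comm_monoid_mult"
  assumes "\<And>i. f i < d"
  shows "(\<Prod>i\<in>UNIV. a (f i)) = (\<Prod>k<d. a k ^ Poly_Mapping.lookup (choice_monomial f) k)"
proof -
  have "(\<Prod>i\<in>UNIV. a (f i)) = (\<Prod>k<d. \<Prod>i\<in>{i \<in> UNIV. f i = k}. a (f i))"
    by (rule prod.group[symmetric]) (use assms in auto)
  then show ?thesis by (simp add: lookup_choice_monomial)
qed

lemma prod_mpoly_var:
  "(\<Prod>i\<in>UNIV. mpoly_var (f i) :: 'a::comm_ring_1 mpoly) = Poly_Mapping.single (choice_monomial f) 1"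
proof -
  have "(\<Prod>i\<in>A. mpoly_var (f i) :: 'a mpoly)
      = Poly_Mapping.single (\<Sum>i\<in>A. Poly_Mapping.single (f i) 1) 1" for A
    by (induction A rule: infinite_finite_induct)
       (simp_all add: mpoly_var_def mult_single)
  then show ?thesis by (simp add: choice_monomial_def)
qed

text \<open>The embedding of constants is a ring homomorphism, and the determinant is an integer
  polynomial in the entries.\<close>

lemma det_mpoly_const:
  "det (\<chi> i j. mpoly_const (A $ i $ j)) = (mpoly_const (det A) :: 'a::comm_ring_1 mpoly)"
proof -
  have mult: "mpoly_const (x * y) = mpoly_const x * (mpoly_const y :: 'a mpoly)" for x y
    by (simp add: mpoly_const_def mult_single)
  have prod: "mpoly_const (\<Prod>i\<in>S. g i) = (\<Prod>i\<in>S. mpoly_const (g i) :: 'a mpoly)" for S :: "'n set" and g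
    by (induction S rule: infinite_finite_induct) (simp_all add: mult, simp_all add: mpoly_const_def)
  have sum: "mpoly_const (\<Sum>i\<in>S. g i) = (\<Sum>i\<in>S. mpoly_const (g i) :: 'a mpoly)" for S :: "('n \<Rightarrow> 'n) set" and g
    by (induction S rule: infinite_finite_induct) (simp_all add: mpoly_const_def single_add)
  have of_int: "mpoly_const (of_int z) = (of_int z :: 'a mpoly)" for z
    by (simp add: mpoly_const_def)
  show ?thesis
    by (simp add: det_def mult prod sum of_int)
qed

text \<open>This is multilinearity in the rows. A general commutative ring allows two uses:
  \<open>a\<close> as the indeterminates, and \<open>a\<close> as a point of evaluation.\<close>

lemma det_linear_combination:
  fixes a :: "nat \<Rightarrow> 'a::comm_ring_1" and C :: "nat \<Rightarrow> 'a^'n^'n"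
  shows "det (\<chi> i j. \<Sum>k<d. a k * C k $ i $ j)
    = (\<Sum>f | \<forall>i. f i < d. (\<Prod>i\<in>UNIV. a (f i)) * det (\<chi> i j. C (f i) $ i $ j))"
proof -
  have choices: "{f :: 'n \<Rightarrow> nat. \<forall>i. f i < d} = PiE UNIV (\<lambda>_. {..<d})"
    by (auto simp: PiE_def)
  have "det (\<chi> i j. \<Sum>k<d. a k * C k $ i $ j)
      = (\<Sum>p | p permutes UNIV. of_int (sign p) *
          (\<Sum>f | \<forall>i. f i < d. \<Prod>i\<in>UNIV. a (f i) * C (f i) $ i $ p i))"
    unfolding choices det_def by (simp add: prod_sum_PiE)
  also have "\<dots> = (\<Sum>f | \<forall>i. f i < d. \<Sum>p | p permutes UNIV. of_int (sign p) *
          (\<Prod>i\<in>UNIV. a (f i) * C (f i) $ i $ p i))"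
    unfolding sum_distrib_left by (rule sum.swap)
  finally show ?thesis
    by (simp add: det_def prod.distrib sum_distrib_left mult.left_commute)
qed

lemma determinantal_poly_eq_sum_single:
  "determinantal_poly d B = (\<Sum>f | \<forall>i. f i < d.
     Poly_Mapping.single (choice_monomial f) (det (\<chi> i j. B (f i) $ i $ j)))"
proof -
  have "determinantal_poly d B = (\<Sum>f | \<forall>i. f i < d.
      (\<Prod>i\<in>UNIV. mpoly_var (f i)) * det (\<chi> i j. mpoly_const (B (f i) $ i $ j)))"
    using det_linear_combination[of mpoly_var "\<lambda>k. \<chi> i j. mpoly_const (B k $ i $ j)" d]
    by (simp add: determinantal_poly_def)
  moreover have "det (\<chi> i j. mpoly_const (B (f i) $ i $ j))
      = mpoly_const (det (\<chi> i j. B (f i) $ i $ j))" for f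
    using det_mpoly_const[of "\<chi> i j. B (f i) $ i $ j"] by simp
  ultimately show ?thesis
    by (simp add: prod_mpoly_var mpoly_const_def mult_single)
qed

lemma finite_bounded_choices: "finite {f :: 'n::finite \<Rightarrow> nat. \<forall>i. f i < d}"
  using finite_PiE[of "UNIV :: 'n set" "\<lambda>_. {..<d}"] by (simp add: PiE_def Pi_def)

lemma lookup_determinantal_poly:
  fixes B :: "nat \<Rightarrow> 'a::comm_ring_1^'n^'n"
  shows "Poly_Mapping.lookup (determinantal_poly d B) m
    = (\<Sum>f\<in>{f. (\<forall>i. f i < d) \<and> choice_monomial f = m}. det (\<chi> i j. B (f i) $ i $ j))"
  by (simp add: determinantal_poly_eq_sum_single lookup_sum lookup_single when_def
      sum.inter_filter[symmetric] finite_bounded_choices)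

text \<open>Only this direction holds in general: choices with the same monomial may cancel.\<close>

lemma determinantal_poly_key:
  fixes B :: "nat \<Rightarrow> 'a::comm_ring_1^'n^'n"
  assumes "m \<in> Poly_Mapping.keys (determinantal_poly d B)"
  obtains f :: "'n \<Rightarrow> nat" where "\<forall>i. f i < d" and "choice_monomial f = m"
proof -
  have "{f :: 'n \<Rightarrow> nat. (\<forall>i. f i < d) \<and> choice_monomial f = m} \<noteq> {}" (is "?F \<noteq> {}")
  proof
    assume "?F = {}"
    then have "Poly_Mapping.lookup (determinantal_poly d B) m = 0"
      by (simp only: lookup_determinantal_poly sum.empty)
    with assms show False by (simp add: in_keys_iff)
  qed
  then show ?thesis using that by blast
qed

text \<open>This is the bridge from the formal polynomial to determinants of actual matrices: the
  expansion at scalars is regrouped by monomial.\<close>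

lemma det_linear_combination_eq_eval:
  fixes B :: "nat \<Rightarrow> 'a::comm_ring_1^'n^'n"
  shows "det (\<chi> i j. \<Sum>k<d. a k * B k $ i $ j)
    = (\<Sum>m\<in>Poly_Mapping.keys (determinantal_poly d B).
        Poly_Mapping.lookup (determinantal_poly d B) m * (\<Prod>k<d. a k ^ Poly_Mapping.lookup m k))"
proof -
  let ?F = "{f :: 'n \<Rightarrow> nat. \<forall>i. f i < d}"
  let ?c = "\<lambda>f. det (\<chi> i j. B (f i) $ i $ j)"
  let ?P = "determinantal_poly d B"
  have "det (\<chi> i j. \<Sum>k<d. a k * B k $ i $ j)
      = (\<Sum>f\<in>?F. ?c f * (\<Prod>k<d. a k ^ Poly_Mapping.lookup (choice_monomial f) k))"
    unfolding det_linear_combination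
    by (rule sum.cong) (simp_all add: prod_eq_choice_monomial[of _ d] mult.commute)
  also have "\<dots> = (\<Sum>m\<in>choice_monomial ` ?F. \<Sum>f\<in>{f \<in> ?F. choice_monomial f = m}.
      ?c f * (\<Prod>k<d. a k ^ Poly_Mapping.lookup (choice_monomial f) k))"
    by (rule sum.group[symmetric]) (use finite_bounded_choices in auto)
  also have "\<dots> =
      (\<Sum>m\<in>choice_monomial ` ?F. Poly_Mapping.lookup ?P m * (\<Prod>k<d. a k ^ Poly_Mapping.lookup m k))"
    by (rule sum.cong) (simp_all add: lookup_determinantal_poly sum_distrib_right)
  also have "\<dots> = (\<Sum>m\<in>Poly_Mapping.keys ?P.
      Poly_Mapping.lookup ?P m * (\<Prod>k<d. a k ^ Poly_Mapping.lookup m k))"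
  \<comment> \<open>Choice monomials whose coefficients cancel are not keys and contribute
    zero.\<close>
  proof (rule sum.mono_neutral_right)
    show "finite (choice_monomial ` ?F)"
      by (rule finite_imageI[OF finite_bounded_choices])
    show "Poly_Mapping.keys ?P \<subseteq> choice_monomial ` ?F"
    proof
      fix m
      assume "m \<in> Poly_Mapping.keys ?P"
      then obtain f :: "'n \<Rightarrow> nat" where "\<forall>i. f i < d" "choice_monomial f = m"
        by (rule determinantal_poly_key)
      then show "m \<in> choice_monomial ` ?F" by blast
    qed
  qed (simp add: in_keys_iff)
  finally show ?thesis .
qed

text \<open>The exponent of \<open>x_k\<close> counts the rows taken from \<open>B k\<close>. If it
  equals the number of rows, only the constant choice contributes, and its matrix is
  \<open>B k\<close> itself.\<close>

lemma lookup_determinantal_poly_pure_power: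
  fixes B :: "nat \<Rightarrow> 'a::comm_ring_1^'n^'n"
  assumes "m \<in> Poly_Mapping.keys (determinantal_poly d B)"
    and "Poly_Mapping.lookup m k = CARD('n)"
  shows "k < d" and "Poly_Mapping.lookup (determinantal_poly d B) m = det (B k)"
proof -
  have const: "f = (\<lambda>_. k)" if "choice_monomial f = m" for f :: "'n \<Rightarrow> nat"
  proof -
    have "card {i. f i = k} = CARD('n)"
      using that assms(2) by (metis lookup_choice_monomial)
    then have "{i. f i = k} = UNIV"
      by (intro card_subset_eq) auto
    then show ?thesis by auto
  qed
  obtain f :: "'n \<Rightarrow> nat" where f: "\<forall>i. f i < d" "choice_monomial f = m"
    using assms(1) by (rule determinantal_poly_key)
  note f_eq = const[OF f(2)]
  show "k < d"
    using f(1) unfolding f_eq by simp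
  have "{f :: 'n \<Rightarrow> nat. (\<forall>i. f i < d) \<and> choice_monomial f = m} = {\<lambda>_. k}" (is "?L = _")
  proof (rule equalityI)
    show "?L \<subseteq> {\<lambda>_. k}"
      using const by (intro subsetI) (metis (mono_tags, lifting) mem_Collect_eq singletonI)
    show "{\<lambda>_. k} \<subseteq> ?L"
      using f unfolding f_eq by simp
  qed
  then have "Poly_Mapping.lookup (determinantal_poly d B) m
      = (\<Sum>f\<in>{\<lambda>_ :: 'n. k}. det (\<chi> i j. B (f i) $ i $ j))"
    by (simp only: lookup_determinantal_poly)
  then show "Poly_Mapping.lookup (determinantal_poly d B) m = det (B k)"
    by (simp add: vec_lambda_eta)
qed

theorem theorem1:
  fixes M :: "('k::{field,finite}^'n^'n) set"
    and B :: "nat \<Rightarrow> 'k^'n^'n"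
    and d :: nat
  assumes "matspace.subspace M"
    and "matspace.dim M = d"
    and "d > 0"
    and "\<And>A. A \<in> M \<Longrightarrow> det A = 0"
    and "ordered_matrix_basis d B M"
    and "determinantal_poly d B \<noteq> 0"
  shows "CARD('k) < CARD('n)"
proof (rule ccontr)
  assume "\<not> CARD('k) < CARD('n)"
  then have le: "CARD('n) \<le> CARD('k)" by simp
  let ?P = "determinantal_poly d B"
  have B: "B k \<in> M" if "k < d" for k
    using assms(5) that by (auto simp: ordered_matrix_basis_def intro: matspace.span_base)
  have exponent: "Poly_Mapping.lookup m k < CARD('k)" if m: "m \<in> Poly_Mapping.keys ?P" for m k
  proof (rule ccontr)
    assume "\<not> Poly_Mapping.lookup m k < CARD('k)"
    moreover obtain f :: "'n \<Rightarrow> nat" where "\<forall>i. f i < d" "choice_monomial f = m"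
      using m by (rule determinantal_poly_key)
    then have "Poly_Mapping.lookup m k \<le> CARD('n)"
      by (metis lookup_choice_monomial card_mono subset_UNIV finite)
    \<comment> \<open>The exponent is at least q and at most n, while n \<le> q.\<close>
    ultimately have "Poly_Mapping.lookup m k = CARD('n)" using le by simp
    from lookup_determinantal_poly_pure_power[OF m this] show False
      using B assms(4) m by (simp add: in_keys_iff)
  qed
  have vanish: "(\<Sum>m\<in>Poly_Mapping.keys ?P.
      Poly_Mapping.lookup ?P m * (\<Prod>k<d. a k ^ Poly_Mapping.lookup m k)) = 0" for a
  proof -
    \<comment> \<open>The value at \<open>a\<close> is the determinant of a linear combination of
      the basis, which lies in \<open>M\<close>.\<close>
    have "(\<chi> i j. \<Sum>k<d. a k * B k $ i $ j) = (\<Sum>k<d. mat_scale (a k) (B k))"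
      by (simp add: vec_eq_iff mat_scale_def)
    moreover have "(\<Sum>k<d. mat_scale (a k) (B k)) \<in> M"
      using assms(1) B by (intro matspace.subspace_sum matspace.subspace_scale) auto
    ultimately show ?thesis
      using assms(4) det_linear_combination_eq_eval[of a B d] by simp
  qed
  have inj: "m = m'"
    if "m \<in> Poly_Mapping.keys ?P" "m' \<in> Poly_Mapping.keys ?P"
      and eq: "\<And>k. k < d \<Longrightarrow> Poly_Mapping.lookup m k = Poly_Mapping.lookup m' k" for m m'
  proof (rule poly_mapping_eqI)
    fix k
    \<comment> \<open>Choices take values below \<open>d\<close>, so no variable from
      \<open>x_d\<close> on occurs, and agreement on the first \<open>d\<close> exponents makes
      monomials equal.\<close>
    have zero: "Poly_Mapping.lookup m k = 0" if "m \<in> Poly_Mapping.keys ?P" "\<not> k < d" for m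
      using that(1)
    proof (rule determinantal_poly_key)
      fix f :: "'n \<Rightarrow> nat"
      assume "\<forall>i. f i < d" "choice_monomial f = m"
      with \<open>\<not> k < d\<close> show ?thesis by (auto simp: lookup_choice_monomial)
    qed
    show "Poly_Mapping.lookup m k = Poly_Mapping.lookup m' k"
      using zero that by (cases "k < d") simp_all
  qed
  have "Poly_Mapping.lookup ?P m = 0" if "m \<in> Poly_Mapping.keys ?P" for m
    using inj exponent vanish that
    by (intro reduced_polynomial_function_eq_0[where S = "Poly_Mapping.keys ?P" and m = m
          and c = "Poly_Mapping.lookup ?P" and e = Poly_Mapping.lookup and d = d]) auto
  then have "Poly_Mapping.lookup ?P m = Poly_Mapping.lookup 0 m" for m
    by (cases "m \<in> Poly_Mapping.keys ?P") (simp_all add: in_keys_iff)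
  then have "?P = 0" by (rule poly_mapping_eqI)
  then show False using assms(6) by contradiction
qed

end
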